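(* Let $\mathbf{L}$ be a complete residuated lattice, let $R,S$ be disjoint relation schemes, and let $\mathcal{D}_1$, $\mathcal{D}_2$, $\mathcal{D}_3$ be ranked data tables (RDTs) over $\mathbf{L}$ on $R\cup S$, $S$, and $R$, respectively. Let $\mathcal{E}_R,\mathcal{E}_S,\mathcal{E}_{R\cup S}$ be the extended active domains, containing tuples built only from the values from $\mathcal{D}_1,\mathcal{D}_2,\mathcal{D}_3$. Put $$E=\mathcal{D}_3\bowtie\bigl((\mathcal{D}_2\bowtie\mathcal{E}_R)\Rightarrow^{\mathcal{E}_{R\cup S}}\mathcal{D}_1\bigr),$$ an RDT on $R\cup S$. Then for all $r\in\mathrm{Tupl}(R)$, $$\bigl(\mathcal{D}_1\div^{\mathcal{D}_3}\mathcal{D}_2\bigr)(r)=\bigl(\mathcal{E}_R\div_{\mathrm{gsdo}}^{E}\mathcal{E}_S\bigr)(r).$$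
   Context: A complete residuated lattice is $\mathbf{L}=\langle L,\wedge,\vee,\otimes,\rightarrow,0,1\rangle$ where $\langle L,\wedge,\vee,0,1\rangle$ is a complete lattice with least element $0$ and greatest element $1$, $\langle L,\otimes,1\rangle$ is a commutative monoid, and $a\otimes b\le c$ iff $a\le b\rightarrow c$ for all $a,b,c\in L$. Each attribute $y$ has a type (set of admissible values) $D_y$; a relation scheme is a finite set of attributes. $\mathrm{Tupl}(R)=\prod_{y\in R}D_y$; for $r\in\mathrm{Tupl}(R)$ and $S\subseteq R$, $r(S)\in\mathrm{Tupl}(S)$ is the restriction of $r$ to $S$. If $r\in\mathrm{Tupl}(R)$, $s\in\mathrm{Tupl}(S)$ agree on $R\cap S$, $rs$ denotes the tuple $r\cup s\in\mathrm{Tupl}(R\cup S)$. An RDT on $R$ is a map $\mathcal{D}:\mathrm{Tupl}(R)\to L$ with $\{r\mid\mathcal{D}(r)>0\}$ finite. Natural join of $\mathcal{D}$ on $R$ and $\mathcal{D}'$ on $S$ (arbitrary schemes): the RDT on $R\cup S$ with $(\mathcal{D}\bowtie\mathcal{D}')(t)=\mathcal{D}(t(R))\otimes\mathcal{D}'(t(S))$. Residuum with range: for $\mathcal{A},\mathcal{B},\mathcal{C}$ on the same scheme, $(\mathcal{A}\Rightarrow^{\mathcal{C}}\mathcal{B})(t)=\mathcal{C}(t)\otimes(\mathcal{A}(t)\rightarrow\mathcal{B}(t))$. Division with range: for $\mathcal{A}$ on $R\cup S$, $\mathcal{B}$ on $S$, $\mathcal{C}$ on $R$ ($R\cap S=\emptyset$),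 $(\mathcal{A}\div^{\mathcal{C}}\mathcal{B})(r)=\bigwedge_{s\in\mathrm{Tupl}(S)}\bigl(\mathcal{C}(r)\otimes(\mathcal{B}(s)\rightarrow\mathcal{A}(rs))\bigr)$. Graded (original) Date's Small Divide: for $\mathcal{A}$ on $R$, $\mathcal{B}$ on $S$, $\mathcal{C}$ on $R\cup S$ ($R\cap S=\emptyset$), $(\mathcal{A}\div^{\mathcal{C}}_{\mathrm{gsdo}}\mathcal{B})(r)=\mathcal{A}(r)\otimes\bigwedge_{s\in\mathrm{Tupl}(S)}\bigl(\mathcal{B}(s)\rightarrow\mathcal{C}(rs)\bigr)$. Extended active domains: for an attribute $y$, let $A_y$ be the (finite) set of all values $t(y)$ where $t$ is a tuple with non-zero score in one of the given tables $\mathcal{D}_1,\mathcal{D}_2,\mathcal{D}_3$ whose scheme contains $y$. For a scheme $Q$, $\mathcal{E}_Q$ is the RDT on $Q$ with $\mathcal{E}_Q(t)=1$ if $t(y)\in A_y$ for all $y\in Q$, and $\mathcal{E}_Q(t)=0$ otherwise.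
   Formalization: The formal theorem additionally assumes that E_S is non-empty (some tuple on S has score 1 in E_S); without this the identity fails, e.g. over {0,1} with R empty, S={y} and all three tables empty, where the left side is 0 and the right side is 1. *)

theory Defs
  imports Main
begin

text \<open>
  The least element \<open>0\<close> of the lattice is \<^const>\<open>bot\<close>, the greatest element is
  \<^term>\<open>1\<close> = \<^const>\<open>top\<close>, and \<open>\<otimes>\<close> is the monoid multiplication \<open>*\<close>.
  The degenerate one-element lattice is allowed.
\<close>

class complete_residuated_lattice = complete_lattice + comm_monoid_mult +
  fixes residuum :: "'a \<Rightarrow> 'a \<Rightarrow> 'a"  (infixr "\<rightarrow>" 60)
  assumes one_eq_top: "1 = top"
    and adjointness: "a * b \<le> c \<longleftrightarrow> a \<le> (b \<rightarrow> c)"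

text \<open>
  All values live in one type \<open>'v\<close>; the type of an attribute \<open>y\<close> is the set \<open>D y\<close>.
  A tuple on \<open>R\<close> is a partial map with domain \<open>R\<close>, so that the restriction \<open>r(S)\<close> is
  \<open>r |` S\<close> and the union \<open>rs\<close> of two tuples agreeing on common attributes is \<open>r ++ s\<close>.
\<close>

type_synonym ('y, 'v) tuple = "'y \<Rightarrow> 'v option"

definition Tupl :: "('y \<Rightarrow> 'v set) \<Rightarrow> 'y set \<Rightarrow> ('y, 'v) tuple set"
  where "Tupl D R = {r. dom r = R \<and> (\<forall>y v. r y = Some v \<longrightarrow> v \<in> D y)}"

text \<open>
  Tables on \<open>R\<close> are total functions of which only the values on \<open>Tupl D R\<close> are
  meaningful.
\<close>

type_synonym ('y, 'v, 'l) table = "('y, 'v) tuple \<Rightarrow> 'l"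

definition is_rdt ::
    "('y \<Rightarrow> 'v set) \<Rightarrow> 'y set \<Rightarrow> ('y, 'v, 'l::complete_residuated_lattice) table \<Rightarrow> bool"
  where "is_rdt D R T \<longleftrightarrow> finite {r \<in> Tupl D R. T r > bot}"

definition natural_join ::
    "'y set \<Rightarrow> 'y set \<Rightarrow> ('y, 'v, 'l::complete_residuated_lattice) table
      \<Rightarrow> ('y, 'v, 'l) table \<Rightarrow> ('y, 'v, 'l) table"
  where "natural_join R S A B t = A (t |` R) * B (t |` S)"

text \<open>In the next three operations the superscript (range) table is the middle argument.\<close>

definition residuum_range ::
    "('y, 'v, 'l::complete_residuated_lattice) table \<Rightarrow> ('y, 'v, 'l) table
      \<Rightarrow> ('y, 'v, 'l) table \<Rightarrow> ('y, 'v, 'l) table"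
  where "residuum_range A C B t = C t * (A t \<rightarrow> B t)"

definition division_range ::
    "('y \<Rightarrow> 'v set) \<Rightarrow> 'y set \<Rightarrow> ('y, 'v, 'l::complete_residuated_lattice) table
      \<Rightarrow> ('y, 'v, 'l) table \<Rightarrow> ('y, 'v, 'l) table \<Rightarrow> ('y, 'v, 'l) table"
  where "division_range D S A C B r = (INF s\<in>Tupl D S. C r * (B s \<rightarrow> A (r ++ s)))"

definition gsdo ::
    "('y \<Rightarrow> 'v set) \<Rightarrow> 'y set \<Rightarrow> ('y, 'v, 'l::complete_residuated_lattice) table
      \<Rightarrow> ('y, 'v, 'l) table \<Rightarrow> ('y, 'v, 'l) table \<Rightarrow> ('y, 'v, 'l) table"
  where "gsdo D S A C B r = A r * (INF s\<in>Tupl D S. B s \<rightarrow> C (r ++ s))"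

text \<open>The given tables are passed as a set of pairs of a scheme and a table on it.\<close>

definition active_values ::
    "('y \<Rightarrow> 'v set) \<Rightarrow> ('y set \<times> ('y, 'v, 'l::complete_residuated_lattice) table) set
      \<Rightarrow> 'y \<Rightarrow> 'v set"
  where "active_values D \<T> y =
    {v. \<exists>(Q, T) \<in> \<T>. y \<in> Q \<and> (\<exists>t \<in> Tupl D Q. T t \<noteq> bot \<and> t y = Some v)}"

definition ext_active_domain ::
    "('y \<Rightarrow> 'v set) \<Rightarrow> ('y set \<times> ('y, 'v, 'l::complete_residuated_lattice) table) set
      \<Rightarrow> 'y set \<Rightarrow> ('y, 'v, 'l) table"
  where "ext_active_domain D \<T> Q t =
    (if \<forall>y\<in>Q. \<exists>v\<in>active_values D \<T> y. t y = Some v then 1 else bot)"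

lemma mult_bot_left: "bot * (a::'l::complete_residuated_lattice) = bot"
  by (simp add: adjointness bot_unique[symmetric])

lemma mult_bot_right: "(a::'l::complete_residuated_lattice) * bot = bot"
  by (metis mult_bot_left mult.commute)

lemma Tupl_restrict: "t \<in> Tupl D Q \<Longrightarrow> R \<subseteq> Q \<Longrightarrow> t |` R \<in> Tupl D R"
  unfolding Tupl_def by (auto simp: restrict_map_def split: if_splits)

lemma is_rdt_natural_join:
  assumes "is_rdt D R A" "is_rdt D S B"
  shows "is_rdt D (R \<union> S) (natural_join R S A B)"
proof -
  let ?X = "{r \<in> Tupl D R. A r > bot}" and ?Y = "{r \<in> Tupl D S. B r > bot}"
  have "{t \<in> Tupl D (R \<union> S). natural_join R S A B t > bot} \<subseteq> (\<lambda>(a,b). a ++ b) ` (?X \<times> ?Y)"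
  proof
    fix t assume t: "t \<in> {t \<in> Tupl D (R \<union> S). natural_join R S A B t > bot}"
    have "t = (t |` R) ++ (t |` S)"
      using t by (auto simp: Tupl_def map_add_def restrict_map_def fun_eq_iff split: option.splits)
    moreover have "A (t |` R) > bot" "B (t |` S) > bot"
      using t by (auto simp: natural_join_def bot.not_eq_extremum[symmetric] mult_bot_left mult_bot_right)
    moreover have "t |` R \<in> Tupl D R" "t |` S \<in> Tupl D S"
      using t by (auto intro: Tupl_restrict)
    ultimately show "t \<in> (\<lambda>(a,b). a ++ b) ` (?X \<times> ?Y)" by force
  qed
  then show ?thesis using assms unfolding is_rdt_def
    by (meson finite_SigmaI finite_imageI finite_subset)
qed

lemma is_rdt_residuum_range: "is_rdt D R C \<Longrightarrow> is_rdt D R (residuum_range A C B)"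
  unfolding is_rdt_def
  by (erule rev_finite_subset)
     (auto simp: residuum_range_def bot.not_eq_extremum[symmetric] mult_bot_left mult_bot_right)

lemma is_rdt_ext_active_domain:
  assumes "finite R" and "finite \<T>" and "\<And>Q T. (Q, T) \<in> \<T> \<Longrightarrow> is_rdt D Q T"
  shows "is_rdt D R (ext_active_domain D \<T> R)"
proof -
  have "finite (active_values D \<T> y)" for y
  proof -
    have "active_values D \<T> y \<subseteq> (\<Union>(Q,T)\<in>\<T>. (\<lambda>t. the (t y)) ` {t \<in> Tupl D Q. T t > bot})"
      unfolding active_values_def by (force simp: bot.not_eq_extremum)
    moreover have "finite (\<Union>(Q,T)\<in>\<T>. (\<lambda>t. the (t y)) ` {t \<in> Tupl D Q. T t > bot})"
      using assms by (auto simp: is_rdt_def)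
    ultimately show ?thesis by (rule finite_subset)
  qed
  then have "finite (\<Union>y\<in>R. active_values D \<T> y)" using assms by auto
  from finite_set_of_finite_maps[OF assms(1) this]
  have "finite {m. dom m = R \<and> ran m \<subseteq> (\<Union>y\<in>R. active_values D \<T> y)}" .
  moreover have "{r \<in> Tupl D R. ext_active_domain D \<T> R r > bot}
      \<subseteq> {m. dom m = R \<and> ran m \<subseteq> (\<Union>y\<in>R. active_values D \<T> y)}"
  proof (rule subsetI)
    fix t assume "t \<in> {r \<in> Tupl D R. ext_active_domain D \<T> R r > bot}"
    then have "dom t = R" and a: "\<forall>y\<in>R. \<exists>v\<in>active_values D \<T> y. t y = Some v"
      by (auto simp: ext_active_domain_def Tupl_def split: if_splits)
    moreover have "ran t \<subseteq> (\<Union>y\<in>R. active_values D \<T> y)"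
    proof
      fix v assume "v \<in> ran t"
      then obtain y where y: "t y = Some v" by (auto simp: ran_def)
      then have "y \<in> R" using \<open>dom t = R\<close> by auto
      then show "v \<in> (\<Union>y\<in>R. active_values D \<T> y)" using a y by force
    qed
    ultimately show "t \<in> {m. dom m = R \<and> ran m \<subseteq> (\<Union>y\<in>R. active_values D \<T> y)}"
      by blast
  qed
  ultimately show ?thesis unfolding is_rdt_def by (rule rev_finite_subset)
qed

end

theory Submission
  imports Defs
begin

text \<open>
  If \<open>D3 r = 0\<close>, both sides vanish, because the index set of the infima is nonempty.
  Otherwise \<open>r\<close> consists of active values. For \<open>s\<close> built from active values the terms of the
  two infima at \<open>s\<close> coincide. For any other \<open>s\<close> we have \<open>D2 s = 0\<close>, so the term on the left is
  \<open>D3 r\<close> and the term on the right is \<open>1\<close>; this makes no difference to the infimum, since every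
  term on the left is at most \<open>D3 r\<close> and there is some \<open>s\<close> of the first kind.
\<close>

lemma residuum_one_left [simp]: "(1 \<rightarrow> b) = (b :: 'l::complete_residuated_lattice)"
  by (metis adjointness antisym mult_1_right order_refl)

lemma residuum_bot_left [simp]: "(bot \<rightarrow> b) = (1 :: 'l::complete_residuated_lattice)"
  by (metis adjointness bot_least mult_bot_right one_eq_top top_unique)

text \<open>Adjointness gives \<open>1 \<le> (a \<rightarrow> a)\<close>; as 1 is the top element,
  every \<open>b\<close> lies below \<open>a \<rightarrow> a\<close>.\<close>

lemma mult_le_left: "a * b \<le> (a :: 'l::complete_residuated_lattice)"
proof -
  have "b \<le> (a \<rightarrow> a)"
    by (metis adjointness mult_1_left one_eq_top order_refl order_trans top_greatest)
  then show ?thesis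
    by (metis adjointness mult.commute)
qed

text \<open>In \<open>r ++ s\<close> the right map overrides the left one, so recovering
  \<open>r\<close> rests on disjointness.\<close>

lemma Tupl_map_add_restrict:
  assumes "r \<in> Tupl D R" "s \<in> Tupl D S" "R \<inter> S = {}"
  shows "(r ++ s) |` R = r" "(r ++ s) |` S = s" "(r ++ s) |` (R \<union> S) = r ++ s"
  using assms
  by (auto simp: Tupl_def restrict_map_def map_add_def fun_eq_iff split: option.splits)

lemma ext_active_domain_cases:
  "ext_active_domain D \<T> Q t = 1 \<or> ext_active_domain D \<T> Q t = bot"
  by (simp add: ext_active_domain_def)

text \<open>The tuple itself witnesses that each of its values is active. Read contrapositively, a
  given table vanishes outside the active domain of its scheme.\<close>

lemma ext_active_domain_nonzero:
  assumes "(Q, T) \<in> \<T>" "t \<in> Tupl D Q" "T t \<noteq> bot"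
  shows "ext_active_domain D \<T> Q t = 1"
proof -
  have "\<exists>v\<in>active_values D \<T> y. t y = Some v" if y: "y \<in> Q" for y
  proof -
    obtain v where "t y = Some v"
      using y assms(2) by (auto simp: Tupl_def)
    then show ?thesis
      using y assms by (auto simp: active_values_def)
  qed
  then show ?thesis
    by (simp add: ext_active_domain_def)
qed

text \<open>Being active is tested attribute by attribute, and each attribute of the union takes its
  value from \<open>r\<close> or from \<open>s\<close>.\<close>

lemma ext_active_domain_map_add:
  fixes \<T> :: "('y set \<times> ('y, 'v, 'l::complete_residuated_lattice) table) set"
  assumes "r \<in> Tupl D R" "s \<in> Tupl D S" "R \<inter> S = {}"
    and "ext_active_domain D \<T> R r = 1" "ext_active_domain D \<T> S s = 1"
  shows "ext_active_domain D \<T> (R \<union> S) (r ++ s) = 1"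
proof (cases "(1::'l) = bot")
  case True
  \<comment> \<open>In the one-element lattice the score 1 says nothing about active values, but
    both possible scores coincide.\<close>
  then show ?thesis
    using ext_active_domain_cases[of D \<T> "R \<union> S" "r ++ s"] by simp
next
  case False
  have "(r ++ s) y = r y" if "y \<in> R" for y
    using that assms(2,3) by (auto simp: Tupl_def map_add_def split: option.splits)
  moreover have "(r ++ s) y = s y" if "y \<in> S" for y
    using that assms(2) by (auto simp: Tupl_def map_add_def split: option.splits)
  ultimately show ?thesis
    using assms(4,5) False by (auto simp: ext_active_domain_def split: if_splits)
qed

theorem theorem10:
  fixes D :: "'y \<Rightarrow> 'v set"
    and R S :: "'y set"
    and D1 D2 D3 E :: "('y, 'v, 'l::complete_residuated_lattice) table"
    and EAD :: "'y set \<Rightarrow> ('y, 'v, 'l) table"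
  assumes "finite R" and "finite S" and "R \<inter> S = {}"
    and "is_rdt D (R \<union> S) D1" and "is_rdt D S D2" and "is_rdt D R D3"
    and "EAD = ext_active_domain D {(R \<union> S, D1), (S, D2), (R, D3)}"
    and "\<exists>s\<in>Tupl D S. EAD S s = 1"
    and "E = natural_join R (R \<union> S) D3
               (residuum_range (natural_join S R D2 (EAD R)) (EAD (R \<union> S)) D1)"
  shows "\<forall>r\<in>Tupl D R. division_range D S D1 D3 D2 r = gsdo D S (EAD R) E (EAD S) r"
proof
  fix r assume r: "r \<in> Tupl D R"
  note EAD = assms(7)
  \<comment> \<open>With no such tuple, every term of the right-hand infimum would be 1, and the
    bound by \<open>D3 r\<close> would be lost.\<close>
  obtain s0 where s0: "s0 \<in> Tupl D S" "EAD S s0 = 1"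
    using assms(8) by blast
  have E: "E (r ++ s) = D3 r * (EAD (R \<union> S) (r ++ s) * (D2 s * EAD R r \<rightarrow> D1 (r ++ s)))"
    if "s \<in> Tupl D S" for s
    using Tupl_map_add_restrict[OF r that assms(3)]
    by (simp add: assms(9) natural_join_def residuum_range_def)
  show "division_range D S D1 D3 D2 r = gsdo D S (EAD R) E (EAD S) r"
  proof (cases "D3 r = bot")
    case True
    \<comment> \<open>The term at \<open>s0\<close> is \<open>1 \<rightarrow> bot\<close>, hence
      \<open>bot\<close>.\<close>
    have "(INF s\<in>Tupl D S. EAD S s \<rightarrow> E (r ++ s)) \<le> (EAD S s0 \<rightarrow> E (r ++ s0))"
      by (rule INF_lower) (rule s0)
    then have "(INF s\<in>Tupl D S. EAD S s \<rightarrow> E (r ++ s)) = bot"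
      using s0 E[OF s0(1)] True by (simp add: mult_bot_left bot_unique)
    moreover have "Tupl D S \<noteq> {}"
      using s0(1) by blast
    then have "division_range D S D1 D3 D2 r = bot"
      using True by (simp add: division_range_def mult_bot_left)
    ultimately show ?thesis
      by (simp add: gsdo_def mult_bot_right)
  next
    case False
    then have EADr: "EAD R r = 1"
      unfolding EAD by (intro ext_active_domain_nonzero[where T = D3] r) auto
    define f where "f s = D3 r * (D2 s \<rightarrow> D1 (r ++ s))" for s
    have active: "(EAD S s \<rightarrow> E (r ++ s)) = f s" if "s \<in> Tupl D S" "EAD S s = 1" for s
    proof -
      \<comment> \<open>Now all active-domain scores equal 1, so \<open>E (r ++ s)\<close> reduces
        to \<open>f s\<close>.\<close>
      have "EAD (R \<union> S) (r ++ s) = 1"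
        using EADr that r assms(3) unfolding EAD by (intro ext_active_domain_map_add)
      then show ?thesis
        using E[OF that(1)] EADr that(2) by (simp add: f_def)
    qed
    have inactive: "f s = D3 r \<and> (EAD S s \<rightarrow> E (r ++ s)) = 1"
      if "s \<in> Tupl D S" "EAD S s \<noteq> 1" for s
    proof -
      have "D2 s = bot"
      proof (rule ccontr)
        assume "D2 s \<noteq> bot"
        then have "EAD S s = 1"
          unfolding EAD by (intro ext_active_domain_nonzero[where T = D2] that) auto
        with that show False by simp
      qed
      moreover have "EAD S s = bot"
        using that(2) ext_active_domain_cases[of D _ S s] unfolding EAD by metis
      ultimately show ?thesis
        by (simp add: f_def)
    qed
    have "(INF s\<in>Tupl D S. f s) = (INF s\<in>Tupl D S. EAD S s \<rightarrow> E (r ++ s))"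
    proof (rule antisym)
      show "(INF s\<in>Tupl D S. f s) \<le> (INF s\<in>Tupl D S. EAD S s \<rightarrow> E (r ++ s))"
      proof (rule INF_mono)
        fix s assume s: "s \<in> Tupl D S"
        then have "f s \<le> (EAD S s \<rightarrow> E (r ++ s))"
          using active[OF s] inactive[OF s] by (cases "EAD S s = 1") (simp_all add: one_eq_top)
        from this s show "\<exists>s'\<in>Tupl D S. f s' \<le> (EAD S s \<rightarrow> E (r ++ s))" ..
      qed
    next
      show "(INF s\<in>Tupl D S. EAD S s \<rightarrow> E (r ++ s)) \<le> (INF s\<in>Tupl D S. f s)"
      proof (rule INF_mono)
        fix s assume s: "s \<in> Tupl D S"
        show "\<exists>s'\<in>Tupl D S. (EAD S s' \<rightarrow> E (r ++ s')) \<le> f s"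
        proof (cases "EAD S s = 1")
          case True
          then show ?thesis
            using active[OF s] s by (intro bexI[of _ s]) simp_all
        next
          case False
          \<comment> \<open>The right-hand term at the inactive \<open>s\<close> is 1, too large to
            serve as a bound; the one at \<open>s0\<close> is \<open>f s0\<close>, which lies below
            \<open>D3 r = f s\<close>.\<close>
          have "f s0 \<le> D3 r"
            unfolding f_def by (rule mult_le_left)
          then show ?thesis
            using active[OF s0] inactive[OF s False] s0(1) by (intro bexI[of _ s0]) simp_all
        qed
      qed
    qed
    then show ?thesis
      using EADr by (simp add: division_range_def gsdo_def f_def)
  qed
qed

end
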